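(* Let $p$ be a prime and $r\ge 1$ an integer. Suppose $f(x) \in \mathbb{Q}[x]$ is a $p^r$-Dumas polynomial of degree $d$. Then $f^n(x)$ is irreducible over $\mathbb{Q}$ for all $n \geq 1$.
   Context: $\nu_p$ denotes the $p$-adic valuation on $\mathbb{Q}$, with $\nu_p(0)=+\infty$. A polynomial $f(x)=a_dx^d+\cdots+a_0\in\mathbb{Q}[x]$ of degree $d$ is $p^r$-pure (for a prime $p$ and an integer $r\ge1$) if $\nu_p(a_d)=0$, $\nu_p(a_0)=r$, and $\frac{\nu_p(a_i)}{d-i}\ge \frac{r}{d}$ for all $0<i<d$. A $p^r$-pure polynomial of degree $d$ is $p^r$-Dumas if $\gcd(r,d)=1$. $f^n$ denotes the $n$-th iterate (composition) of $f$. *)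

theory Defs
  imports "HOL-Library.Extended_Real" "HOL-Computational_Algebra.Computational_Algebra"
begin

(* quotient_of returns the coprime numerator and denominator of a rational.  The values are
   extended reals so that the value at 0 can be infinite and so that they can be divided. *)
definition padic_val :: "nat \<Rightarrow> rat \<Rightarrow> ereal" where
  "padic_val p x =
     (if x = 0 then \<infinity>
      else case quotient_of x of (a, b) \<Rightarrow>
        ereal (real (multiplicity (int p) a) - real (multiplicity (int p) b)))"

(* A zero coefficient has value \<infinity>, and \<infinity> divided by a positive real is again \<infinity>,
   so it satisfies the slope condition. Degree 0 is excluded for r \<ge> 1, since then
   the leading and the constant coefficient coincide. *)
definition pure_poly :: "nat \<Rightarrow> nat \<Rightarrow> rat poly \<Rightarrow> bool" where
  "pure_poly p r f \<longleftrightarrow>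
     (let d = degree f in
        padic_val p (coeff f d) = 0 \<and>
        padic_val p (coeff f 0) = ereal (real r) \<and>
        (\<forall>i. 0 < i \<and> i < d \<longrightarrow>
           padic_val p (coeff f i) / ereal (real (d - i)) \<ge> ereal (real r / real d)))"

definition dumas_poly :: "nat \<Rightarrow> nat \<Rightarrow> rat poly \<Rightarrow> bool" where
  "dumas_poly p r f \<longleftrightarrow> pure_poly p r f \<and> gcd r (degree f) = 1"

definition poly_iterate :: "nat \<Rightarrow> rat poly \<Rightarrow> rat poly" where
  "poly_iterate n f = ((\<lambda>g. f \<circ>\<^sub>p g) ^^ n) [:0, 1:]"

end

theory Submission
  imports Defs
begin

text \<open>
  For a slope \<open>s\<close>, give the monomial \<open>a x\<^sup>i\<close> the weight \<open>v(a) + s i\<close> and a polynomial the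
  minimum weight of its monomials; by Gauss's argument this weight is additive on products.
  A polynomial \<open>h\<close> of degree \<open>D\<close> that is pure of height \<open>r\<close> has weight \<open>r\<close> for \<open>s = r/D\<close>, attained
  at both ends. If \<open>h = A B\<close>, then the weight of \<open>A\<close> is also attained at both ends, so
  \<open>s deg A\<close> is an integer, and \<open>D\<close> divides \<open>deg A\<close> when \<open>r\<close> and \<open>D\<close> are coprime.
  If \<open>f\<close> has weight at least \<open>r\<close> for the slope \<open>r/d\<close> and \<open>g\<close> has weight at least \<open>r\<close> for the
  slope \<open>r/d\<^sup>n\<close>, then \<open>g\<close> has weight at least \<open>r/d\<close> for the slope \<open>r/d\<^sup>n\<^sup>+\<^sup>1\<close>, whence \<open>f \<circ> g\<close> has
  weight at least \<open>r\<close> for that slope. So iterates stay pure, with degree \<open>d\<^sup>n\<close> still coprime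
  to \<open>r\<close>. In degree 1 the height of an iterate may grow, but there irreducibility is trivial.
\<close>

section \<open>Integer valuations on a field\<close>

locale int_valuation =
  fixes v :: "'a::field \<Rightarrow> int"
  assumes val_mult: "x \<noteq> 0 \<Longrightarrow> y \<noteq> 0 \<Longrightarrow> v (x * y) = v x + v y"
    and val_add: "x \<noteq> 0 \<Longrightarrow> y \<noteq> 0 \<Longrightarrow> x + y \<noteq> 0 \<Longrightarrow> min (v x) (v y) \<le> v (x + y)"
begin

lemma val_one: "v 1 = 0"
  using val_mult[of 1 1] by simp

lemma val_minus: "v (- x) = v x"
proof (cases "x = 0")
  case False
  have "v (-1) = 0"
    using val_mult[of "-1" "-1"] val_one by simp
  then show ?thesis
    using val_mult[of "-1" x] False by simp
qed simp

lemma val_power: "x \<noteq> 0 \<Longrightarrow> v (x ^ n) = int n * v x"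
  by (induction n) (simp_all add: val_one val_mult algebra_simps)

text \<open>Treats 0 as having infinite value, since the locale leaves \<open>v 0\<close>
  unconstrained. The bound is real because slopes are fractional.\<close>

definition val_ge :: "real \<Rightarrow> 'a \<Rightarrow> bool" where
  "val_ge c x \<longleftrightarrow> x = 0 \<or> c \<le> real_of_int (v x)"

lemma val_ge_0 [simp]: "val_ge c 0"
  by (simp add: val_ge_def)

lemma val_ge_mono: "val_ge c x \<Longrightarrow> c' \<le> c \<Longrightarrow> val_ge c' x"
  by (auto simp: val_ge_def)

lemma val_ge_add: "val_ge c x \<Longrightarrow> val_ge c y \<Longrightarrow> val_ge c (x + y)"
  using val_add[of x y] by (cases "x = 0 \<or> y = 0 \<or> x + y = 0") (auto simp: val_ge_def min_def split: if_splits)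

lemma val_ge_sum: "(\<And>i. i \<in> S \<Longrightarrow> val_ge c (g i)) \<Longrightarrow> val_ge c (sum g S)"
  by (induction S rule: infinite_finite_induct) (auto intro: val_ge_add)

lemma val_ge_mult: "val_ge c x \<Longrightarrow> val_ge c' y \<Longrightarrow> val_ge (c + c') (x * y)"
  using val_mult[of x y] by (cases "x = 0 \<or> y = 0") (auto simp: val_ge_def)

lemma val_add_dominant:
  assumes "x \<noteq> 0" and "val_ge c y" and "real_of_int (v x) < c"
  shows "x + y \<noteq> 0 \<and> v (x + y) = v x"
proof (cases "y = 0")
  case False
  then have lt: "v x < v y"
    using assms by (auto simp: val_ge_def)
  \<comment> \<open>Otherwise \<open>x = - y\<close>, and the two values would agree.\<close>
  have nz: "x + y \<noteq> 0"
    using lt val_minus[of y] by (auto simp: add_eq_0_iff2)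
  have "v x \<le> v (x + y)"
    using val_add[of x y] nz False assms lt by simp
  moreover have "min (v (x + y)) (v y) \<le> v x"
    using val_add[of "x + y" "- y"] nz False assms val_minus[of y] by simp
  ultimately show ?thesis
    using nz lt by auto
qed (use assms in auto)

section \<open>Weights of polynomials\<close>

text \<open>Geometrically, the Newton polygon lies on or above the line of slope \<open>-s\<close>
  through \<open>(0, c)\<close>.\<close>

definition weight_ge :: "real \<Rightarrow> real \<Rightarrow> 'a poly \<Rightarrow> bool" where
  "weight_ge s c f \<longleftrightarrow> (\<forall>i. val_ge (c - s * real i) (coeff f i))"

lemma weight_ge_add: "weight_ge s c f \<Longrightarrow> weight_ge s c g \<Longrightarrow> weight_ge s c (f + g)"
  by (auto simp: weight_ge_def intro: val_ge_add)

lemma weight_ge_const: "val_ge c a \<Longrightarrow> weight_ge s c [:a:]"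
  by (auto simp: weight_ge_def coeff_pCons split: nat.splits)

lemma weight_ge_mult:
  assumes "weight_ge s c f" and "weight_ge s c' g"
  shows "weight_ge s (c + c') (f * g)"
  unfolding weight_ge_def coeff_mult
proof (intro allI val_ge_sum)
  fix n i :: nat assume "i \<in> {..n}"
  then have "c + c' - s * real n = (c - s * real i) + (c' - s * real (n - i))"
    by (simp add: of_nat_diff algebra_simps)
  then show "val_ge (c + c' - s * real n) (coeff f i * coeff g (n - i))"
    using assms val_ge_mult unfolding weight_ge_def by metis
qed

lemma weight_ge_pCons:
  "weight_ge s c (pCons a f) \<longleftrightarrow> val_ge c a \<and> weight_ge s (c - s) f"
  unfolding weight_ge_def
  by (auto simp: algebra_simps coeff_pCons split: nat.splits)

text \<open>The slope \<open>s\<close> is the weight of the variable of \<open>f\<close>, and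
  \<open>g\<close> weighs at least that much, so substitution loses nothing. The induction follows
  Horner's scheme.\<close>

lemma weight_ge_pcompose:
  assumes "weight_ge t s g" and "weight_ge s c f"
  shows "weight_ge t c (f \<circ>\<^sub>p g)"
  using assms(2)
proof (induction f arbitrary: c)
  case 0
  then show ?case by (simp add: weight_ge_def)
next
  case (pCons a f)
  then have a: "val_ge c a" and "weight_ge t (c - s) (f \<circ>\<^sub>p g)"
    by (auto simp: weight_ge_pCons)
  then have "weight_ge t (s + (c - s)) (g * (f \<circ>\<^sub>p g))"
    using assms(1) weight_ge_mult by blast
  then show ?case
    using weight_ge_add[OF weight_ge_const[OF a]] by (simp add: pcompose_pCons)
qed

lemma val_ge_poly:
  assumes "val_ge s x" and "weight_ge s c f"
  shows "val_ge c (poly f x)"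
  \<comment> \<open>Evaluation at \<open>x\<close> is composition with the constant polynomial
    \<open>[:x:]\<close>; its slope is arbitrary and taken as 0.\<close>
  using weight_ge_pcompose[OF weight_ge_const[OF assms(1)] assms(2), of 0,
      unfolded weight_ge_def, rule_format, of 0]
  by (simp add: poly_0_coeff_0[symmetric] poly_pcompose)

section \<open>Gauss's lemma for weights\<close>

lemma first_minimal_weight:
  assumes "f \<noteq> 0"
  obtains m where "coeff f m \<noteq> 0"
    and "weight_ge s (real_of_int (v (coeff f m)) + s * real m) f"
    and "\<And>i. i < m \<Longrightarrow> coeff f i \<noteq> 0 \<Longrightarrow>
           real_of_int (v (coeff f m)) + s * real m < real_of_int (v (coeff f i)) + s * real i"
proof -
  define W where "W i = real_of_int (v (coeff f i)) + s * real i" for i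
  define S where "S = {i. coeff f i \<noteq> 0}"
  have "S \<subseteq> {..degree f}"
    by (auto simp: S_def le_degree)
  then have fin: "finite S"
    by (rule finite_subset) simp
  have "degree f \<in> S"
    using assms by (simp add: S_def)
  then obtain k where k: "k \<in> S" "\<And>i. i \<in> S \<Longrightarrow> W k \<le> W i"
    using ex_is_arg_min_if_finite[OF fin, of W] by (auto simp: is_arg_min_linorder)
  define m where "m = (LEAST i. i \<in> S \<and> W i = W k)"
  have m: "m \<in> S \<and> W m = W k"
    unfolding m_def by (rule LeastI[of _ k]) (use k in auto)
  have first: "W m < W i" if "i < m" "i \<in> S" for i
    using not_less_Least[of i "\<lambda>i. i \<in> S \<and> W i = W k"] that k(2)[of i] m
    by (fastforce simp: m_def)
  show ?thesis
  proof
    show "coeff f m \<noteq> 0"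
      using m by (simp add: S_def)
    show "weight_ge s (real_of_int (v (coeff f m)) + s * real m) f"
      using k(2) m by (auto simp: weight_ge_def val_ge_def S_def W_def algebra_simps)
    show "real_of_int (v (coeff f m)) + s * real m < real_of_int (v (coeff f i)) + s * real i"
      if "i < m" "coeff f i \<noteq> 0" for i
      using first that by (simp add: S_def W_def)
  qed
qed

text \<open>Gauss's lemma: at the sum of the first indices of minimal weight, one product term
  strictly dominates all others.\<close>

lemma weight_ge_mult_split:
  assumes f: "f \<noteq> 0" and g: "g \<noteq> 0" and fg: "weight_ge s c (f * g)"
  obtains a b where "weight_ge s a f" and "weight_ge s b g" and "c \<le> a + b"
proof -
  obtain m where m: "coeff f m \<noteq> 0"
    "weight_ge s (real_of_int (v (coeff f m)) + s * real m) f"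
    "\<And>i. i < m \<Longrightarrow> coeff f i \<noteq> 0 \<Longrightarrow>
       real_of_int (v (coeff f m)) + s * real m < real_of_int (v (coeff f i)) + s * real i"
    using first_minimal_weight[OF f] by metis
  obtain n where n: "coeff g n \<noteq> 0"
    "weight_ge s (real_of_int (v (coeff g n)) + s * real n) g"
    "\<And>i. i < n \<Longrightarrow> coeff g i \<noteq> 0 \<Longrightarrow>
       real_of_int (v (coeff g n)) + s * real n < real_of_int (v (coeff g i)) + s * real i"
    using first_minimal_weight[OF g] by metis
  define t where "t i = coeff f i * coeff g (m + n - i)" for i
  have tm: "t m \<noteq> 0" "v (t m) = v (coeff f m) + v (coeff g n)"
    using m n val_mult by (auto simp: t_def)
  \<comment> \<open>Values are integers, so a strict excess is at least 1; this uniform gap survives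
    summation.\<close>
  have "val_ge (v (t m) + 1) (t i)" if "i \<in> {..m + n} - {m}" for i
  proof (cases "t i = 0")
    case False
    then have nz: "coeff f i \<noteq> 0" "coeff g (m + n - i) \<noteq> 0"
      by (auto simp: t_def)
    have vt: "v (t i) = v (coeff f i) + v (coeff g (m + n - i))"
      using nz val_mult by (simp add: t_def)
    have ge: "real_of_int (v (coeff f m)) + s * real m \<le> real_of_int (v (coeff f i)) + s * real i"
      "real_of_int (v (coeff g n)) + s * real n
        \<le> real_of_int (v (coeff g (m + n - i))) + s * real (m + n - i)"
      using m(2) n(2) nz by (auto simp: weight_ge_def val_ge_def algebra_simps)
    have "s * real i + s * real (m + n - i) = s * real m + s * real n"
      using that by (simp add: of_nat_diff algebra_simps)
    \<comment> \<open>One factor precedes the first index of minimal weight, which makes one of the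
      two bounds strict.\<close>
    moreover have "i < m \<or> m + n - i < n"
      using that by auto
    ultimately have "real_of_int (v (t m)) < real_of_int (v (t i))"
      unfolding tm vt using ge m(3)[of i] n(3)[of "m + n - i"] nz by force
    then show ?thesis
      by (simp add: val_ge_def)
  qed simp
  then have "val_ge (v (t m) + 1) (sum t ({..m + n} - {m}))"
    by (rule val_ge_sum)
  then have "t m + sum t ({..m + n} - {m}) \<noteq> 0
      \<and> v (t m + sum t ({..m + n} - {m})) = v (t m)"
    by (intro val_add_dominant tm) auto
  moreover have "coeff (f * g) (m + n) = t m + sum t ({..m + n} - {m})"
    unfolding coeff_mult t_def[symmetric] by (rule sum.remove) auto
  moreover have "val_ge (c - s * real (m + n)) (coeff (f * g) (m + n))"
    using fg unfolding weight_ge_def by blast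
  ultimately have "c - s * real (m + n) \<le> real_of_int (v (t m))"
    by (auto simp: val_ge_def)
  then have "c \<le> (real_of_int (v (coeff f m)) + s * real m) + (real_of_int (v (coeff g n)) + s * real n)"
    by (simp add: tm algebra_simps)
  then show thesis
    using that m(2) n(2) by blast
qed

section \<open>Dumas's irreducibility criterion\<close>

theorem dumas_irreducible:
  fixes h :: "'a poly" and r :: nat
  assumes D: "degree h = D" "D > 0"
    and lead: "v (lead_coeff h) = 0"
    and const: "coeff h 0 \<noteq> 0" "v (coeff h 0) = int r"
    and weight: "weight_ge (real r / real D) (real r) h"
    and coprime: "coprime r D"
  shows "irreducible h"
proof (rule irreducibleI)
  show "h \<noteq> 0"
    using const by auto
  then show "\<not> is_unit h"
    using D by (simp add: is_unit_iff_degree)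
  fix A B assume h: "h = A * B"
  then have nz: "A \<noteq> 0" "B \<noteq> 0"
    using const by auto
  let ?s = "real r / real D"
  obtain a b where ab: "weight_ge ?s a A" "weight_ge ?s b B" "real r \<le> a + b"
    using weight_ge_mult_split nz weight h by metis
  have deg: "D = degree A + degree B"
    using D h nz by (simp add: degree_mult_eq)
  have c0: "coeff A 0 \<noteq> 0" "coeff B 0 \<noteq> 0" "v (coeff A 0) + v (coeff B 0) = int r"
    using const h val_mult by (auto simp: coeff_mult)
  have l0: "v (lead_coeff A) + v (lead_coeff B) = 0"
    using lead h nz val_mult by (simp add: lead_coeff_mult)
  have le0: "a \<le> v (coeff A 0)" "b \<le> v (coeff B 0)"
    using ab(1,2)[unfolded weight_ge_def, rule_format, of 0] c0 by (auto simp: val_ge_def)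
  have leD: "a \<le> v (lead_coeff A) + ?s * degree A" "b \<le> v (lead_coeff B) + ?s * degree B"
    using ab(1)[unfolded weight_ge_def, rule_format, of "degree A"]
      ab(2)[unfolded weight_ge_def, rule_format, of "degree B"] nz by (auto simp: val_ge_def)
  have "?s * degree A + ?s * degree B = ?s * D"
    using deg by (metis distrib_left of_nat_add)
  then have "?s * degree A + ?s * degree B = r"
    using D by simp
  moreover have "real_of_int (v (coeff A 0)) + real_of_int (v (coeff B 0)) = r"
    "real_of_int (v (lead_coeff A)) + real_of_int (v (lead_coeff B)) = 0"
    using c0(3) l0 by linarith+
  \<comment> \<open>The bounds at the constant and at the leading terms each add up to
    \<open>r\<close>, while \<open>r \<le> a + b\<close>. Hence all are equalities, and
    \<open>a\<close> is the weight of both end terms of \<open>A\<close>.\<close>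
  ultimately have "?s * degree A = real_of_int (v (coeff A 0) - v (lead_coeff A))"
    using le0 leD ab(3) by simp
  then have "real r * real (degree A) = real_of_int (v (coeff A 0) - v (lead_coeff A)) * real D"
    using D by (simp add: field_simps)
  then have "int r * int (degree A) = (v (coeff A 0) - v (lead_coeff A)) * int D"
    by (simp only: of_int_eq_iff[where ?'a = real, symmetric] of_int_mult of_int_of_nat_eq)
  then have "int D dvd int (r * degree A)"
    unfolding of_nat_mult by (metis dvd_triv_right)
  then have "D dvd degree A"
    using coprime by (metis coprime_commute coprime_dvd_mult_right_iff int_dvd_int_iff)
  \<comment> \<open>A multiple of \<open>D\<close> that is at most \<open>D\<close> is 0 or
    \<open>D\<close>.\<close>
  then have "degree A = 0 \<or> degree B = 0"
    using deg by (auto dest: dvd_imp_le)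
  then show "is_unit A \<or> is_unit B"
    using nz by (simp add: is_unit_iff_degree)
qed

end

section \<open>The p-adic valuation on the rationals\<close>

definition padic_ord :: "nat \<Rightarrow> rat \<Rightarrow> int" where
  "padic_ord p x = (case quotient_of x of (a, b) \<Rightarrow>
     int (multiplicity (int p) a) - int (multiplicity (int p) b))"

lemma padic_val_eq_ord: "padic_val p x = (if x = 0 then \<infinity> else ereal (real_of_int (padic_ord p x)))"
  by (simp add: padic_val_def padic_ord_def split: prod.splits)

text \<open>Cross-multiplying with the reduced fraction and comparing multiplicities frees later
  computations from lowest terms.\<close>

lemma padic_ord_div:
  assumes p: "prime p" and ab: "a \<noteq> 0" "b \<noteq> 0"
  shows "padic_ord p (of_int a / of_int b)
    = int (multiplicity (int p) a) - int (multiplicity (int p) b)"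
proof -
  obtain c d where cd: "quotient_of (of_int a / of_int b) = (c, d)"
    by (cases "quotient_of (of_int a / of_int b)")
  have d: "d \<noteq> 0"
    using quotient_of_denom_pos[OF cd] by simp
  have "(of_int a / of_int b :: rat) = of_int c / of_int d"
    using quotient_of_div[OF cd] .
  then have "(of_int (a * d) :: rat) = of_int (c * b)"
    using ab d by (simp add: field_simps)
  then have eq: "a * d = c * b"
    by (simp only: of_int_eq_iff)
  have c: "c \<noteq> 0"
    using eq ab d by auto
  have pe: "prime_elem (int p)"
    using p by auto
  have "multiplicity (int p) a + multiplicity (int p) d = multiplicity (int p) c + multiplicity (int p) b"
    using prime_elem_multiplicity_mult_distrib[OF pe] eq ab c d by metis
  then show ?thesis
    by (simp add: padic_ord_def cd)
qed

lemma int_valuation_padic_ord: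
  assumes p: "prime p"
  shows "int_valuation (padic_ord p)"
proof
  have pe: "prime_elem (int p)"
    using p by auto
  note md = prime_elem_multiplicity_mult_distrib[OF pe]
  fix x y :: rat assume x: "x \<noteq> 0" and y: "y \<noteq> 0"
  obtain a b where ab: "x = of_int a / of_int b" "a \<noteq> 0" "b \<noteq> 0"
    using x by (metis divide_eq_0_iff of_int_0 quotient_of_div surj_pair)
  obtain c d where cd: "y = of_int c / of_int d" "c \<noteq> 0" "d \<noteq> 0"
    using y by (metis divide_eq_0_iff of_int_0 quotient_of_div surj_pair)
  note ord = padic_ord_div[OF p]
  have "of_int a / of_int b * (of_int c / of_int d) = (of_int (a * c) / of_int (b * d) :: rat)"
    by simp
  then show "padic_ord p (x * y) = padic_ord p x + padic_ord p y"
    unfolding ab(1) cd(1) using ab cd by (simp add: ord md del: of_int_mult)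
  assume xy: "x + y \<noteq> 0"
  have sum: "x + y = of_int (a * d + c * b) / of_int (b * d)"
    using ab cd by (simp add: field_simps)
  then have nz: "a * d + c * b \<noteq> 0"
    using xy by (metis div_0 of_int_0)
  \<comment> \<open>Over the common denominator \<open>b * d\<close>, only the numerators need
    comparing.\<close>
  let ?m = "min (multiplicity (int p) (a * d)) (multiplicity (int p) (c * b))"
  have "int p ^ ?m dvd a * d + c * b"
    by (intro dvd_add multiplicity_dvd') auto
  then have "?m \<le> multiplicity (int p) (a * d + c * b)"
    using nz pe by (intro multiplicity_geI) (auto simp: prime_elem_def)
  then show "min (padic_ord p x) (padic_ord p y) \<le> padic_ord p (x + y)"
    unfolding sum unfolding ab(1) cd(1)
    using ab cd nz by (simp add: ord md del: of_int_add of_int_mult)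
qed

section \<open>Valuations of iterates\<close>

lemma degree_poly_iterate: "degree (poly_iterate n f) = degree f ^ n"
  by (induction n) (simp_all add: poly_iterate_def degree_pcompose)

lemma poly_iterate_Suc: "poly_iterate (Suc n) f = f \<circ>\<^sub>p poly_iterate n f"
  by (simp add: poly_iterate_def)

locale rat_valuation = int_valuation v for v :: "rat \<Rightarrow> int"
begin

lemma val_lead_coeff_iterate:
  assumes "degree f > 0" and "v (lead_coeff f) = 0"
  shows "v (lead_coeff (poly_iterate n f)) = 0"
proof (induction n)
  case 0
  then show ?case by (simp add: poly_iterate_def val_one)
next
  case (Suc n)
  have "degree (poly_iterate n f) > 0"
    using assms by (simp add: degree_poly_iterate)
  moreover from this have "lead_coeff (poly_iterate n f) \<noteq> 0" and "lead_coeff f \<noteq> 0"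
    using assms by auto
  ultimately show ?case
    using assms Suc
    unfolding poly_iterate_Suc by (simp add: lead_coeff_comp val_mult val_power)
qed

lemma weight_ge_iterate:
  fixes r :: nat
  assumes d: "degree f = d" "d > 0" and weight: "weight_ge (real r / real d) (real r) f"
  shows "weight_ge (real r / real (d ^ n)) (real r) (poly_iterate n f)"
proof (induction n)
  case 0
  then show ?case
    by (auto simp: poly_iterate_def weight_ge_def val_ge_def val_one coeff_pCons split: nat.splits)
next
  case (Suc n)
  let ?g = "poly_iterate n f"
  have "weight_ge (real r / real (d ^ Suc n)) (real r / real d) ?g"
    unfolding weight_ge_def
  proof
    fix i
    show "val_ge (real r / real d - real r / real (d ^ Suc n) * real i) (coeff ?g i)"
    proof (cases "i \<le> d ^ n")
      case True
      \<comment> \<open>The required bound is the inductive one divided by \<open>d\<close>. The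
        latter is nonnegative for \<open>i \<le> d ^ n\<close>, so division only weakens it.\<close>
      have "real r / real d - real r / real (d ^ Suc n) * real i
          = real r / real (d ^ n) * (real (d ^ n) - real i) * (1 / real d)"
        using d by (simp add: field_simps)
      also have "\<dots> \<le> real r / real (d ^ n) * (real (d ^ n) - real i) * 1"
        using d True of_nat_mono[OF True, where ?'a = real] by (intro mult_left_mono) auto
      also have "\<dots> = real r - real r / real (d ^ n) * real i"
        using d by (simp add: field_simps)
      finally show ?thesis
        using Suc val_ge_mono unfolding weight_ge_def by blast
    next
      case False
      then have "coeff ?g i = 0"
        using d by (intro coeff_eq_0) (simp add: degree_poly_iterate)
      then show ?thesis by simp
    qed
  qed
  then show ?case
    unfolding poly_iterate_Suc using weight by (rule weight_ge_pcompose)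
qed

text \<open>Writing \<open>f\<close> as \<open>a + X * g\<close>, the new constant term is
  \<open>a + x * poly g x\<close> with \<open>x\<close> the old one, and \<open>a\<close> strictly
  dominates. The index starts at \<open>Suc n\<close> because the iterate of index 0 is the
  variable, with constant term 0.\<close>

lemma val_coeff_0_iterate:
  fixes r :: nat
  assumes d: "degree f = d" "d \<ge> 2" and r: "r > 0"
    and weight: "weight_ge (real r / real d) (real r) f"
    and const: "coeff f 0 \<noteq> 0" "v (coeff f 0) = int r"
  shows "coeff (poly_iterate (Suc n) f) 0 \<noteq> 0 \<and> v (coeff (poly_iterate (Suc n) f) 0) = int r"
proof -
  let ?s = "real r / real d"
  obtain a g where f: "f = pCons a g"
    by (cases f)
  define x where "x = coeff (poly_iterate n f) 0"
  have "weight_ge (real r / real (d ^ n)) (real r) (poly_iterate n f)"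
    using weight_ge_iterate d weight by simp
  then have x: "val_ge (real r) x"
    unfolding weight_ge_def x_def by (metis diff_zero mult_zero_right of_nat_0)
  \<comment> \<open>Here \<open>d \<ge> 2\<close> enters: it makes \<open>r + (r - ?s)\<close>, the
    bound for \<open>x * poly g x\<close>, exceed \<open>r = v a\<close>.\<close>
  have s: "?s < real r"
    using d r by (simp add: field_simps)
  have "weight_ge ?s (real r - ?s) g"
    using weight by (simp add: f weight_ge_pCons)
  moreover have "val_ge ?s x"
    using x s val_ge_mono by (metis less_imp_le)
  ultimately have "val_ge (real r + (real r - ?s)) (x * poly g x)"
    using val_ge_mult x val_ge_poly by blast
  then have "a + x * poly g x \<noteq> 0 \<and> v (a + x * poly g x) = v a"
    using const s by (intro val_add_dominant) (auto simp: f)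
  moreover have "coeff (poly_iterate (Suc n) f) 0 = a + x * poly g x"
    by (simp add: x_def poly_iterate_Suc f poly_0_coeff_0[symmetric] poly_pcompose)
  ultimately show ?thesis
    using const by (simp add: f)
qed

end

section \<open>From pure polynomials to irreducible iterates\<close>

lemma pure_polyD:
  assumes p: "prime p" and r: "r \<ge> 1" and pure: "pure_poly p r f"
  shows "degree f > 0" and "padic_ord p (lead_coeff f) = 0"
    and "coeff f 0 \<noteq> 0" and "padic_ord p (coeff f 0) = int r"
    and "int_valuation.weight_ge (padic_ord p) (real r / real (degree f)) (real r) f"
proof -
  interpret int_valuation "padic_ord p"
    using p by (rule int_valuation_padic_ord)
  have lead: "padic_val p (lead_coeff f) = 0" and const: "padic_val p (coeff f 0) = ereal (real r)"
    and slope: "\<And>i. 0 < i \<Longrightarrow> i < degree f \<Longrightarrow>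
      ereal (real r / real (degree f)) \<le> padic_val p (coeff f i) / ereal (real (degree f - i))"
    using pure by (auto simp: pure_poly_def Let_def)
  \<comment> \<open>In degree 0 the same coefficient would have values 0 and
    \<open>r \<ge> 1\<close>.\<close>
  show deg: "degree f > 0"
    using lead const r by (cases "degree f = 0") auto
  show lead': "padic_ord p (lead_coeff f) = 0"
    using lead by (auto simp: padic_val_eq_ord split: if_splits)
  show "coeff f 0 \<noteq> 0" and const': "padic_ord p (coeff f 0) = int r"
    using const by (auto simp: padic_val_eq_ord split: if_splits)
  show "weight_ge (real r / real (degree f)) (real r) f"
    unfolding weight_ge_def
  proof
    fix i
    consider "i = 0" | "0 < i" "i < degree f" "coeff f i \<noteq> 0" | "i = degree f" | "coeff f i = 0"
      using le_degree[of f i] by linarith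
    then show "val_ge (real r - real r / real (degree f) * real i) (coeff f i)"
    proof cases
      case 2
      then have "real r / real (degree f) \<le> real_of_int (padic_ord p (coeff f i)) / real (degree f - i)"
        using slope[of i] by (simp add: padic_val_eq_ord)
      then have "real r / real (degree f) * (real (degree f) - real i) \<le> padic_ord p (coeff f i)"
        using 2 by (simp add: pos_le_divide_eq of_nat_diff)
      moreover have "real r / real (degree f) * (real (degree f) - real i)
          = real r - real r / real (degree f) * real i"
        using deg by (simp add: field_simps)
      ultimately show ?thesis
        by (simp add: val_ge_def)
    \<comment> \<open>At the two ends the bound is \<open>r\<close> and 0, attained exactly.\<close>
    qed (use deg lead' const' in \<open>auto simp: val_ge_def\<close>)
  qed
qed

lemma irreducible_degree_1:
  fixes f :: "'a::field poly"
  assumes "degree f = 1"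
  shows "irreducible f"
proof (rule irreducibleI)
  show "f \<noteq> 0"
    using assms by auto
  then show "\<not> is_unit f"
    using assms by (simp add: is_unit_iff_degree)
  fix A B assume f: "f = A * B"
  then have "A \<noteq> 0" "B \<noteq> 0"
    using \<open>f \<noteq> 0\<close> by auto
  then show "is_unit A \<or> is_unit B"
    using assms f by (auto simp: degree_mult_eq is_unit_iff_degree)
qed

theorem corollary1p5:
  fixes p r d :: nat and f :: "rat poly"
  assumes "prime p" and "r \<ge> 1"
    and "degree f = d" and "dumas_poly p r f"
  shows "\<forall>n\<ge>1. irreducible (poly_iterate n f)"
proof (intro allI impI)
  fix n :: nat assume "n \<ge> 1"
  then obtain m where n: "n = Suc m"
    by (cases n) auto
  interpret rat_valuation "padic_ord p"
    using assms(1) by (intro rat_valuation.intro int_valuation_padic_ord)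
  have pure: "pure_poly p r f" and coprime: "coprime r d"
    using assms by (auto simp: dumas_poly_def coprime_iff_gcd_eq_1)
  note f = pure_polyD[OF assms(1,2) pure, unfolded \<open>degree f = d\<close>]
  show "irreducible (poly_iterate n f)"
  proof (cases "d = 1")
    case True
    then show ?thesis
      using assms(3) by (intro irreducible_degree_1) (simp add: degree_poly_iterate)
  next
    case False
    then have const: "coeff (poly_iterate n f) 0 \<noteq> 0" "padic_ord p (coeff (poly_iterate n f) 0) = int r"
      using val_coeff_0_iterate[OF assms(3) _ _ f(5) f(3,4), of m] f(1) assms(2) by (auto simp: n)
    show ?thesis
    proof (rule dumas_irreducible)
      show "degree (poly_iterate n f) = d ^ n"
        using assms(3) by (simp add: degree_poly_iterate)
      show "d ^ n > 0"
        using f(1) by simp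
      show "padic_ord p (lead_coeff (poly_iterate n f)) = 0"
        using f(1,2) assms(3) by (intro val_lead_coeff_iterate) auto
      show "weight_ge (real r / real (d ^ n)) (real r) (poly_iterate n f)"
        using assms(3) f(1,5) by (rule weight_ge_iterate)
      show "coprime r (d ^ n)"
        using coprime by simp
    qed (use const in auto)
  qed
qed

end
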